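(* Let $A \in \mathbb{R}^{m \times n}$, $M \in \mathbb{R}^{n \times p}$ and $P \in \mathbb{R}^{n \times m}$ be given matrices with $\operatorname{rank}(A) = k \le n \le m$ and $\operatorname{rank}(M) = n \le p$. Let $r \le k$ be a positive integer and let $\eta \ge 0$ be a real parameter, with $\eta \neq 0$ if $r < m$. Define $$F = (I_n - PA)MM^{\top}A^{\top} - \eta^2 P \in \mathbb{R}^{n \times m}.$$ If $\operatorname{rank}(F) \ge r$, then a global minimizer $\widehat Z \in \mathbb{R}^{n \times m}$ of the problem $$\min_{\operatorname{rank}(Z) \le r} f(Z) = \left\| Z \begin{bmatrix} AM & \eta I_m \end{bmatrix} - \begin{bmatrix} M - PAM & -\eta P \end{bmatrix} \right\|_{\mathrm F}^2$$ (over $Z \in \mathbb{R}^{n\times m}$) is given by $$\widehat Z = U_{H,r} U_{H,r}^{\top} F \left(AMM^{\top}A^{\top} + \eta^2 I_m\right)^{-1},$$ where the symmetric matrix $H = F\left(AMM^{\top}A^{\top} + \eta^2 I_m\right)^{-1}F^{\top} \in \mathbb{R}^{n\times n}$ has eigenvalue decomposition $H = U_H \Lambda_H U_H^{\top}$ ($U_H$ orthogonal, $\Lambda_H = \operatorname{diag}(\lambda_1,\dots,\lambda_n)$) with eigenvalues ordered so that $\lambda_j \ge \lambda_i$ for $j < i \le n$, and $U_{H,r}$ contains the first $r$ columns of $U_H$. Moreover, $\widehat Z$ is the unique global minimizer of this problem if and only if $\lambda_r > \lambda_{r+1}$ (with the convention $\lambda_{n+1} := 0$ when $r = n$).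
   Context: $\|\cdot\|_{\mathrm F}$ denotes the Frobenius norm, $I_n$ the $n \times n$ identity matrix, $^{\top}$ the transpose, and $[X \ \ Y]$ denotes horizontal concatenation of matrices. All matrices are real. *)

theory Defs
  imports
    Complex_Main
    "Jordan_Normal_Form.DL_Rank"
    "Jordan_Normal_Form.Gauss_Jordan_Elimination"
begin

definition frobenius_norm :: "real mat \<Rightarrow> real" where
  "frobenius_norm X = sqrt (\<Sum>i<dim_row X. \<Sum>j<dim_col X. (X $$ (i, j))\<^sup>2)"

(* Meaningful only when X and Y have the same number of rows. *)
definition hconcat :: "'a mat \<Rightarrow> 'a mat \<Rightarrow> 'a mat" where
  "hconcat X Y = mat (dim_row X) (dim_col X + dim_col Y)
     (\<lambda>(i, j). if j < dim_col X then X $$ (i, j) else Y $$ (i, j - dim_col X))"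

(* mat_inverse returns an option; for a singular matrix the value here is unspecified. *)
definition mat_inv :: "'a::field mat \<Rightarrow> 'a mat" where
  "mat_inv X = the (mat_inverse X)"

(* The library's orthogonal_mat only asks for pairwise orthogonal nonzero columns;
   here the columns are orthonormal. *)
definition real_orthogonal_mat :: "nat \<Rightarrow> real mat \<Rightarrow> bool" where
  "real_orthogonal_mat n U \<longleftrightarrow>
     U \<in> carrier_mat n n \<and> U\<^sup>T * U = 1\<^sub>m n \<and> U * U\<^sup>T = 1\<^sub>m n"

definition first_cols :: "nat \<Rightarrow> 'a mat \<Rightarrow> 'a mat" where
  "first_cols r U = mat_of_cols (dim_row U) (take r (cols U))"

(* The first argument of vec_space.rank is the number of rows of the matrix. *)
definition rank_at_most :: "nat \<Rightarrow> nat \<Rightarrow> nat \<Rightarrow> real mat set" where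
  "rank_at_most n m r = {Z \<in> carrier_mat n m. vec_space.rank n Z \<le> r}"

end

theory Submission
  imports Defs "HOL-Library.Indicator_Function"
begin

text \<open>
  Put B = [A M, \<eta> I] and C = [M - P A M, - \<eta> P]. Block multiplication gives
  G = B B^T and F = C B^T, so f Z = |Z B - C|^2 is a linear least squares
  objective with Gram matrix G, and K = F G^-1 is its unconstrained minimizer. The
  hypotheses on \<eta> and on the ranks of A and M are what makes G invertible
  (det_regularized_gram, full_row_rank_transpose_inj). With Y = K B, the matrix H
  is Y Y^T.
  
  Two applications of the Pythagorean theorem for the Frobenius inner product do
  the rest. The residual K B - C is orthogonal to every matrix X B, so
  f Z = f K + |Z B - Y|^2 (err_eq). If E is an orthogonal projection with E Z = Z,
  then Z B - E Y has its columns in the range of E and E Y - Y in the orthogonal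
  complement, whence (err_orth_proj)
  
    f Z = |(Z - E K) B|^2 + (f K + |Y|^2) - trace (E H).
  
  A matrix Z of rank at most r is fixed by an orthogonal projection of trace at
  most r, namely the one onto its column space (orth_proj_of_rank). Minimizing f
  thus amounts to maximizing trace (E H) over such projections and then taking
  Z = E K. By Ky Fan's principle the maximum is the sum of the r largest
  eigenvalues, attained at E = U_r U_r^T, and only there if there is a gap after
  the r-th eigenvalue (ky_fan_orth_proj). This gives the minimizer U_r U_r^T K and
  its uniqueness under a gap.
  
  Since rank F is at least r, the r-th eigenvalue is positive; otherwise F would
  be fixed by the projection onto r - 1 eigenvectors. Hence without a gap
  r < n, the eigenvalues r and r + 1 agree, and exchanging the corresponding
  eigenvectors produces another minimizer; it is different because the eigenvalue
  is not zero.
\<close>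

section \<open>Trace and Frobenius norm\<close>

definition mat_trace :: "real mat \<Rightarrow> real" where
  "mat_trace X = (\<Sum>i<dim_row X. X $$ (i, i))"

lemma mat_trace_add:
  assumes "X \<in> carrier_mat n n" "Y \<in> carrier_mat n n"
  shows "mat_trace (X + Y) = mat_trace X + mat_trace Y"
  using assms by (auto simp: mat_trace_def sum.distrib)

lemma mat_trace_mult:
  assumes "X \<in> carrier_mat n m" "Y \<in> carrier_mat m n"
  shows "mat_trace (X * Y) = (\<Sum>i<n. \<Sum>j<m. X $$ (i, j) * Y $$ (j, i))"
  using assms by (auto simp: mat_trace_def scalar_prod_def atLeast0LessThan intro!: sum.cong)

lemma mat_trace_comm:
  assumes "X \<in> carrier_mat n m" "Y \<in> carrier_mat m n"
  shows "mat_trace (X * Y) = mat_trace (Y * X)"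
  unfolding mat_trace_mult[OF assms] mat_trace_mult[OF assms(2,1)]
  by (subst sum.swap) (simp add: mult.commute)

lemma frobenius_norm_sq_trace:
  assumes "X \<in> carrier_mat n m"
  shows "(frobenius_norm X)\<^sup>2 = mat_trace (X * X\<^sup>T)"
  using assms
  by (auto simp: frobenius_norm_def mat_trace_mult[of _ n m] sum_nonneg power2_eq_square
      intro!: sum.cong)

lemma frobenius_norm_sq_eq_0D:
  assumes X: "X \<in> carrier_mat n m" and "(frobenius_norm X)\<^sup>2 = 0"
  shows "X = 0\<^sub>m n m"
proof -
  have "(\<Sum>i<n. \<Sum>j<m. (X $$ (i, j))\<^sup>2) = 0"
    using assms by (auto simp: frobenius_norm_def)
  then have "X $$ (i, j) = 0" if "i < n" "j < m" for i j
    using that by (auto simp: sum_nonneg_eq_0_iff sum_nonneg)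
  then show ?thesis
    using X by (intro eq_matI) auto
qed

lemma frobenius_pythagoras:
  assumes X: "X \<in> carrier_mat n m" and Y: "Y \<in> carrier_mat n m"
    and orth: "mat_trace (X * Y\<^sup>T) = 0"
  shows "(frobenius_norm (X + Y))\<^sup>2 = (frobenius_norm X)\<^sup>2 + (frobenius_norm Y)\<^sup>2"
proof -
  have "(\<Sum>i<n. \<Sum>j<m. (X $$ (i, j) + Y $$ (i, j))\<^sup>2) =
    (\<Sum>i<n. \<Sum>j<m. (X $$ (i, j))\<^sup>2) + (\<Sum>i<n. \<Sum>j<m. (Y $$ (i, j))\<^sup>2)
      + 2 * (\<Sum>i<n. \<Sum>j<m. X $$ (i, j) * Y $$ (i, j))"
    by (simp add: power2_sum sum.distrib sum_distrib_left mult.assoc)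
  moreover have "(\<Sum>i<n. \<Sum>j<m. X $$ (i, j) * Y $$ (i, j)) = mat_trace (X * Y\<^sup>T)"
    using Y by (subst mat_trace_mult[OF X]) (auto intro!: sum.cong)
  ultimately show ?thesis
    using X Y orth by (simp add: frobenius_norm_def sum_nonneg)
qed

section \<open>Orthogonal projections\<close>

definition orth_proj :: "nat \<Rightarrow> real mat \<Rightarrow> bool" where
  "orth_proj n E \<longleftrightarrow> E \<in> carrier_mat n n \<and> E\<^sup>T = E \<and> E * E = E"

lemma orth_projD:
  assumes "orth_proj n E"
  shows "E \<in> carrier_mat n n" "E\<^sup>T = E" "E * E = E"
  using assms by (auto simp: orth_proj_def)

text \<open>
  Compare the diagonal entries of E = E E^T. That every diagonal entry is a sum of
  squares containing its own square is what confines it to the unit interval.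
\<close>
lemma orth_proj_diag_sum:
  assumes "orth_proj n E" "i < n"
  shows "E $$ (i, i) = (\<Sum>j<n. (E $$ (i, j))\<^sup>2)"
proof -
  note E = orth_projD[OF assms(1)]
  have "E $$ (i, i) = (E * E\<^sup>T) $$ (i, i)" by (simp add: E)
  also have "\<dots> = (\<Sum>j<n. (E $$ (i, j))\<^sup>2)"
    using E(1) assms(2) by (auto simp: scalar_prod_def power2_eq_square atLeast0LessThan)
  finally show ?thesis .
qed

lemma orth_proj_diag_bounds:
  assumes "orth_proj n E" "i < n"
  shows "0 \<le> E $$ (i, i)" "E $$ (i, i) \<le> 1"
proof -
  note s = orth_proj_diag_sum[OF assms]
  show "0 \<le> E $$ (i, i)" unfolding s by (simp add: sum_nonneg)
  have "(E $$ (i, i))\<^sup>2 \<le> E $$ (i, i)"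
    by (subst (2) s, rule member_le_sum) (use assms(2) in auto)
  then show "E $$ (i, i) \<le> 1"
    by (smt (verit) power2_eq_square mult_left_le_imp_le mult_cancel_right1 mult_less_cancel_right2)
qed

text \<open>
  If a diagonal entry equals its own square, then no room is left for the other
  squares in its row. This turns the equality case of Ky Fan's inequality, which
  only speaks about diagonal entries, into an identity of matrices.
\<close>
lemma orth_proj_diag_01:
  assumes E: "orth_proj n E"
    and d: "\<And>i. i < n \<Longrightarrow> E $$ (i, i) = d i" "\<And>i. i < n \<Longrightarrow> d i = 0 \<or> d i = 1"
  shows "E = mat_diag n d"
proof -
  have off: "E $$ (i, j) = 0" if ij: "i < n" "j < n" "i \<noteq> j" for i j
  proof -
    have "E $$ (i, i) = (E $$ (i, i))\<^sup>2 + (\<Sum>j\<in>{..<n}-{i}. (E $$ (i, j))\<^sup>2)"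
      using ij orth_proj_diag_sum[OF E ij(1)] by (simp add: sum.remove[of "{..<n}" i])
    moreover have "(E $$ (i, i))\<^sup>2 = E $$ (i, i)"
      using d[OF ij(1)] by auto
    ultimately have "(\<Sum>j\<in>{..<n}-{i}. (E $$ (i, j))\<^sup>2) = 0" by simp
    then show ?thesis
      using ij by (subst (asm) sum_nonneg_eq_0_iff) auto
  qed
  show ?thesis
    using orth_projD(1)[OF E] d(1) off by (intro eq_matI) (auto simp: mat_diag_def)
qed

text \<open>
  A Gram-Schmidt step on the level of projections: with x = v - E v, which is
  orthogonal to the range of E, the rank-one projection x x^T / (x . x) is added
  to E. It raises the trace by one; if x = 0, nothing has to be done.
\<close>
lemma orth_proj_add_vector:
  assumes E: "orth_proj n E" and v: "v \<in> carrier_vec n"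
  obtains E' where "orth_proj n E'" "mat_trace E' \<le> mat_trace E + 1" "E' *\<^sub>v v = v"
    "\<And>u. u \<in> carrier_vec n \<Longrightarrow> E *\<^sub>v u = u \<Longrightarrow> E' *\<^sub>v u = u"
proof (cases "E *\<^sub>v v = v")
  case True
  with E show ?thesis by (intro that[of E]) auto
next
  case False
  note EE = orth_projD[OF E]
  define x where "x = v - E *\<^sub>v v"
  have x: "x \<in> carrier_vec n" using v EE(1) by (auto simp: x_def)
  have Ex: "E *\<^sub>v x = 0\<^sub>v n"
  proof -
    have "E *\<^sub>v x = E *\<^sub>v v - (E * E) *\<^sub>v v"
      using v EE(1) by (simp add: x_def mult_minus_distrib_mat_vec[of _ n n])
    then show ?thesis using v EE by auto
  qed
  have "x \<noteq> 0\<^sub>v n"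
  proof
    assume "x = 0\<^sub>v n"
    then have "v - E *\<^sub>v v + E *\<^sub>v v = E *\<^sub>v v" using EE(1) v by (simp add: x_def)
    moreover have "v - E *\<^sub>v v + E *\<^sub>v v = v" using EE(1) v by (intro eq_vecI) auto
    ultimately show False using False by simp
  qed
  define c where "c = x \<bullet> x"
  have c: "c > 0" using \<open>x \<noteq> 0\<^sub>v n\<close> x unfolding c_def
    using conjugate_square_greater_0_vec[OF x] by simp
  define D where "D = mat n n (\<lambda>(i, j). x $ i * x $ j / c)"
  have D: "D \<in> carrier_mat n n" by (simp add: D_def)
  have DT: "D\<^sup>T = D" by (intro eq_matI) (auto simp: D_def mult.commute)
  have Du: "D *\<^sub>v u = ((x \<bullet> u) / c) \<cdot>\<^sub>v x" if "u \<in> carrier_vec n" for u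
    using that x by (intro eq_vecI)
      (auto simp: D_def scalar_prod_def sum_distrib_left sum_divide_distrib sum_distrib_right intro!: sum.cong)
  have DD: "D * D = D"
  proof (intro eq_matI)
    fix i j assume "i < dim_row D" "j < dim_col D"
    then have ij: "i < n" "j < n" by (auto simp: D_def)
    have "(D * D) $$ (i, j) = (\<Sum>k<n. x $ i * x $ k / c * (x $ k * x $ j / c))"
      using ij by (auto simp: D_def scalar_prod_def atLeast0LessThan intro!: sum.cong)
    also have "\<dots> = x $ i * x $ j / (c * c) * (\<Sum>k<n. x $ k * x $ k)"
      by (auto simp: sum_distrib_left intro!: sum.cong)
    also have "(\<Sum>k<n. x $ k * x $ k) = c"
      using x by (auto simp: c_def scalar_prod_def atLeast0LessThan)
    finally show "(D * D) $$ (i, j) = D $$ (i, j)" using c ij by (simp add: D_def)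
  qed (auto simp: D_def)
  have ED: "E * D = 0\<^sub>m n n"
  proof (intro eq_matI)
    fix i j assume "i < dim_row (0\<^sub>m n n :: real mat)" "j < dim_col (0\<^sub>m n n :: real mat)"
    then have ij: "i < n" "j < n" by auto
    have "(E * D) $$ (i, j) = (\<Sum>k<n. E $$ (i, k) * (x $ k * x $ j / c))"
      using ij EE(1) by (auto simp: D_def scalar_prod_def atLeast0LessThan intro!: sum.cong)
    also have "\<dots> = (E *\<^sub>v x) $ i * (x $ j / c)"
      using ij EE(1) x by (auto simp: scalar_prod_def atLeast0LessThan sum_distrib_right sum_divide_distrib mult.assoc intro!: sum.cong)
    finally show "(E * D) $$ (i, j) = (0\<^sub>m n n) $$ (i, j)" using ij by (simp add: Ex)
  qed (use EE(1) D in auto)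
  have "D * E = (E * D)\<^sup>T"
    using EE(1,2) D DT by (simp add: transpose_mult[of _ n n _ n])
  then have DE: "D * E = 0\<^sub>m n n" by (simp add: ED)
  have xEu: "x \<bullet> (E *\<^sub>v u) = 0" if u: "u \<in> carrier_vec n" for u
  proof -
    have "x \<bullet> (E *\<^sub>v u) = (E\<^sup>T *\<^sub>v x) \<bullet> u"
      using transpose_vec_mult_scalar[OF EE(1) u x]
      by (simp add: EE(2))
    then show ?thesis using u by (simp add: EE(2) Ex)
  qed
  have E'D: "(E + D) *\<^sub>v u = E *\<^sub>v u + D *\<^sub>v u" if "u \<in> carrier_vec n" for u
    using that EE(1) D by (simp add: add_mult_distrib_mat_vec[of _ n n])
  show ?thesis
  proof (rule that[of "E + D"])
    show "orth_proj n (E + D)"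
      unfolding orth_proj_def
    proof (intro conjI)
      show "E + D \<in> carrier_mat n n" using EE(1) D by simp
      show "(E + D)\<^sup>T = E + D" using EE(1,2) D DT by (simp add: transpose_add)
      have "(E + D) * (E + D) = E * E + D * E + (E * D + D * D)"
        using EE(1) D by (simp add: add_mult_distrib_mat[of _ n n _ _ n] mult_add_distrib_mat[of _ n n _ n])
      then show "(E + D) * (E + D) = E + D" using EE D by (simp add: ED DE DD)
    qed
    have "mat_trace D = (\<Sum>k<n. x $ k * x $ k) / c"
      by (simp add: mat_trace_def D_def sum_divide_distrib)
    also have "(\<Sum>k<n. x $ k * x $ k) = c"
      using x by (auto simp: c_def scalar_prod_def atLeast0LessThan)
    finally show "mat_trace (E + D) \<le> mat_trace E + 1"
      using mat_trace_add[OF EE(1) D] c by simp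
    have "v = x + E *\<^sub>v v" using v EE(1) by (intro eq_vecI) (auto simp: x_def)
    then have "x \<bullet> v = x \<bullet> x + x \<bullet> (E *\<^sub>v v)"
      using v x EE(1) scalar_prod_add_distrib[of x n x "E *\<^sub>v v"] by simp
    then have "D *\<^sub>v v = x" using Du[OF v] xEu[OF v] c by (simp add: c_def)
    then have "(E + D) *\<^sub>v v = E *\<^sub>v v + (v - E *\<^sub>v v)" by (simp add: E'D v x_def)
    also have "\<dots> = v" using v EE(1) by (intro eq_vecI) auto
    finally show "(E + D) *\<^sub>v v = v" .
    fix u assume u: "u \<in> carrier_vec n" "E *\<^sub>v u = u"
    with xEu[OF u(1)] have "x \<bullet> u = 0" by simp
    then have "D *\<^sub>v u = 0\<^sub>v n" using x u(1) by (intro eq_vecI) (auto simp: Du)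
    then show "(E + D) *\<^sub>v u = u" using u by (simp add: E'D)
  qed
qed

lemma orth_proj_fixing:
  assumes "finite S" "S \<subseteq> carrier_vec n"
  shows "\<exists>E. orth_proj n E \<and> mat_trace E \<le> real (card S) \<and> (\<forall>v\<in>S. E *\<^sub>v v = v)"
  using assms
proof (induction S)
  case empty
  show ?case by (intro exI[of _ "0\<^sub>m n n"]) (auto simp: orth_proj_def mat_trace_def)
next
  case (insert v S)
  then obtain E where E: "orth_proj n E" "mat_trace E \<le> card S" "\<forall>v\<in>S. E *\<^sub>v v = v" by auto
  from insert.prems have v: "v \<in> carrier_vec n" by auto
  obtain E' where "orth_proj n E'" "mat_trace E' \<le> mat_trace E + 1" "E' *\<^sub>v v = v"
    "\<And>u. u \<in> carrier_vec n \<Longrightarrow> E *\<^sub>v u = u \<Longrightarrow> E' *\<^sub>v u = u"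
    using orth_proj_add_vector[OF E(1) v] by blast
  with E insert show ?case by (intro exI[of _ E']) auto
qed

section \<open>Rank and column space\<close>

text \<open>
  Orthogonality to vectors is the one linear condition tested on spanning sets
  below: both E z = z, read off row by row, and w . w = 0 are of this form.
\<close>
lemma span_orthogonal:
  fixes S :: "real vec set"
  assumes S: "finite S" "S \<subseteq> carrier_vec n" and w: "w \<in> carrier_vec n"
    and orth: "\<And>s. s \<in> S \<Longrightarrow> w \<bullet> s = 0"
    and v: "v \<in> LinearCombinations.module.span class_ring (module_vec TYPE(real) n) S"
  shows "w \<bullet> v = 0"
proof -
  interpret vec_space "TYPE(real)" n .
  obtain a where a: "v = lincomb a S"
    using v S finite_span by auto
  have "w \<bullet> v = (\<Sum>i<n. w $ i * (\<Sum>s\<in>S. a s * s $ i))"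
    using S w by (auto simp: a scalar_prod_def lincomb_index lincomb_dim atLeast0LessThan intro!: sum.cong)
  also have "\<dots> = (\<Sum>s\<in>S. a s * (\<Sum>i<n. w $ i * s $ i))"
    by (simp add: sum_distrib_left, subst sum.swap) (simp add: ac_simps)
  also have "\<dots> = (\<Sum>s\<in>S. a s * (w \<bullet> s))"
    using S by (intro sum.cong) (auto simp: scalar_prod_def atLeast0LessThan)
  finally show ?thesis using orth by simp
qed

lemma rank_column_basis:
  fixes Z :: "real mat"
  assumes Z: "Z \<in> carrier_mat n m"
  obtains S where "finite S" "S \<subseteq> set (cols Z)" "card S = vec_space.rank n Z"
    "module.lin_indpt class_ring (module_vec TYPE(real) n) S"
    "set (cols Z) \<subseteq> LinearCombinations.module.span class_ring (module_vec TYPE(real) n) S"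
proof -
  interpret vec_space "TYPE(real)" n .
  have cols: "set (cols Z) \<subseteq> carrier_vec n" using Z cols_dim by blast
  have "lin_indpt {}" by (rule finite_lin_indpt2) auto
  then have "\<exists>S. finite S \<and> maximal S (\<lambda>T. T \<subseteq> set (cols Z) \<and> lin_indpt T) \<and> {} \<subseteq> S"
    by (intro maximal_exists_superset[of "set (cols Z)"]) auto
  then obtain S where S: "finite S" "maximal S (\<lambda>T. T \<subseteq> set (cols Z) \<and> lin_indpt T)"
    by blast
  from S(2) have S': "S \<subseteq> set (cols Z)" "lin_indpt S" by (auto simp: maximal_def)
  have span: "v \<in> span S" if v: "v \<in> set (cols Z)" for v
  proof (rule ccontr)
    assume nv: "v \<notin> span S"
    then have "v \<notin> S" using in_own_span[of S] S' cols by auto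
    moreover have "lin_indpt (insert v S)"
      using lin_dep_iff_in_span[of S v] S' cols v nv \<open>v \<notin> S\<close> by auto
    ultimately show False using S(2) v S'(1) unfolding maximal_def by blast
  qed
  have "set (cols Z) \<subseteq> span S" using span by blast
  from that[OF S(1) S'(1) rank_card_indpt[OF Z S(2), symmetric] S'(2) this] show ?thesis .
qed

text \<open>
  A maximal independent set of columns has as many elements as the rank. The
  projection built from it has at most this trace; it fixes these columns, hence
  their span, hence all columns.
\<close>
lemma orth_proj_of_rank:
  assumes Z: "Z \<in> carrier_mat n m"
  obtains E where "orth_proj n E" "mat_trace E \<le> real (vec_space.rank n Z)" "E * Z = Z"
proof -
  obtain S where S: "finite S" "S \<subseteq> set (cols Z)" "card S = vec_space.rank n Z"
    "set (cols Z) \<subseteq> LinearCombinations.module.span class_ring (module_vec TYPE(real) n) S"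
    by (rule rank_column_basis[OF Z])
  have Sn: "S \<subseteq> carrier_vec n" using S(2) Z cols_dim by blast
  obtain E where E: "orth_proj n E" "mat_trace E \<le> card S" "\<forall>v\<in>S. E *\<^sub>v v = v"
    using orth_proj_fixing[OF S(1) Sn] by blast
  note EE = orth_projD[OF E(1)]
  have "E * Z = Z"
  proof (intro eq_matI)
    fix i j assume "i < dim_row Z" "j < dim_col Z"
    then have ij: "i < n" "j < m" using Z by auto
    let ?w = "row E i - unit_vec n i"
    have w: "?w \<bullet> v = (E *\<^sub>v v) $ i - v $ i" if "v \<in> carrier_vec n" for v
      using that EE(1) ij by (simp add: minus_scalar_prod_distrib[of _ n])
    have "?w \<bullet> col Z j = 0"
    proof (rule span_orthogonal[OF S(1) Sn])
      show "?w \<in> carrier_vec n" using EE(1) ij by auto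
      show "?w \<bullet> s = 0" if "s \<in> S" for s using w[of s] that Sn E(3) by auto
      show "col Z j \<in> LinearCombinations.module.span class_ring (module_vec TYPE(real) n) S"
        using S(4) ij Z by (auto simp: cols_def)
    qed
    moreover have "col Z j \<in> carrier_vec n" using Z ij by auto
    ultimately show "(E * Z) $$ (i, j) = Z $$ (i, j)"
      using w[of "col Z j"] ij Z EE(1) by auto
  qed (use EE(1) Z in auto)
  with E S(3) show ?thesis by (intro that[of E]) auto
qed

text \<open>
  Columns of rank n span the whole space, so a vector orthogonal to all of them is
  orthogonal to itself.
\<close>
lemma full_row_rank_transpose_inj:
  fixes M :: "real mat"
  assumes M: "M \<in> carrier_mat n p" and rk: "vec_space.rank n M = n"
    and w: "w \<in> carrier_vec n" and 0: "M\<^sup>T *\<^sub>v w = 0\<^sub>v p"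
  shows "w = 0\<^sub>v n"
proof -
  interpret vec_space "TYPE(real)" n .
  obtain S where S: "finite S" "S \<subseteq> set (cols M)" "card S = n" "lin_indpt S"
    using rank_column_basis[OF M] rk by metis
  have Sn: "S \<subseteq> carrier_vec n" using S(2) M cols_dim by blast
  have "basis S" using S Sn by (intro dim_li_is_basis) (auto simp: dim_is_n)
  then have "w \<in> span S" using w by (simp add: basis_def)
  moreover have "w \<bullet> s = 0" if s: "s \<in> S" for s
  proof -
    from s S(2) M obtain j where j: "j < p" "s = col M j" by (auto simp: cols_def)
    have "(M\<^sup>T *\<^sub>v w) $ j = col M j \<bullet> w" using j M by simp
    then show ?thesis using 0 j M w by (metis comm_scalar_prod col_carrier_vec carrier_matD index_zero_vec(1))
  qed
  ultimately have "w \<bullet> w = 0" using span_orthogonal[OF S(1) Sn w] by blast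
  then show ?thesis using conjugate_square_eq_0_vec[OF w] by simp
qed

section \<open>Ky Fan's maximum principle\<close>

text \<open>
  The linear program behind Ky Fan's principle: a total weight of at most r, with
  at most 1 at each index, is best spent on the r largest values. With
  c = l (r - 1) as threshold, moving weight from an index beyond r to one below r
  gains at least as much as it loses, and unused weight gains at least 0. Under
  the strict gap every such move is profitable, so the optimal weights are forced.
\<close>
lemma weighted_sum_le_top:
  fixes w l :: "nat \<Rightarrow> real"
  assumes r: "0 < r" "r \<le> n"
    and w: "\<And>i. i < n \<Longrightarrow> 0 \<le> w i" "\<And>i. i < n \<Longrightarrow> w i \<le> 1" "(\<Sum>i<n. w i) \<le> real r"
    and l: "\<And>i j. j < i \<Longrightarrow> i < n \<Longrightarrow> l i \<le> l j" "\<And>i. i < n \<Longrightarrow> 0 \<le> l i"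
  shows "(\<Sum>i<n. w i * l i) \<le> (\<Sum>i<r. l i)"
    and "(\<Sum>i<n. w i * l i) = (\<Sum>i<r. l i) \<Longrightarrow> (if r = n then 0 else l r) < l (r - 1) \<Longrightarrow>
      i < n \<Longrightarrow> w i = (if i < r then 1 else 0)"
proof -
  define c where "c = l (r - 1)"
  define d where "d i = ((if i < r then 1 else 0) - w i) * (l i - c)" for i
  have c0: "0 \<le> c" using l(2) r by (auto simp: c_def)
  have top: "(\<Sum>i<n. (if i < r then g i else 0)) = (\<Sum>i<r. g i)" for g :: "nat \<Rightarrow> real"
    using r by (subst sum.inter_filter[symmetric]) (auto intro!: sum.cong)
  \<comment> \<open>The loss of the weights w is a sum of nonnegative contributions d,
    plus the loss from not using up the total weight r.\<close>
  have "(\<Sum>i<n. d i) = (\<Sum>i<n. (if i < r then l i else 0) - w i * l i - c * (if i < r then 1 else 0) + c * w i)"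
    by (intro sum.cong) (auto simp: d_def algebra_simps)
  also have "\<dots> = (\<Sum>i<r. l i) - (\<Sum>i<n. w i * l i) - c * real r + c * (\<Sum>i<n. w i)"
    unfolding sum.distrib sum_subtractf top sum_distrib_left[symmetric] by simp
  finally have eq: "(\<Sum>i<r. l i) - (\<Sum>i<n. w i * l i) = (\<Sum>i<n. d i) + c * (real r - (\<Sum>i<n. w i))"
    by (simp add: algebra_simps)
  have d0: "0 \<le> d i" if i: "i < n" for i
  proof (cases "i < r")
    case True
    then have "l i \<ge> c" using l(1)[of i "r - 1"] r by (cases "i = r - 1") (auto simp: c_def)
    then show ?thesis using True w(2)[OF i] by (simp add: d_def)
  next
    case False
    then have "l i \<le> c" using l(1)[of "r - 1" i] i r by (auto simp: c_def)
    then show ?thesis using False w(1)[OF i] by (simp add: d_def mult_nonneg_nonpos)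
  qed
  have slack: "0 \<le> c * (real r - (\<Sum>i<n. w i))" using c0 w(3) by simp
  have dn: "0 \<le> (\<Sum>i<n. d i)" using d0 by (intro sum_nonneg) auto
  show "(\<Sum>i<n. w i * l i) \<le> (\<Sum>i<r. l i)"
    using eq slack dn by linarith
  assume e: "(\<Sum>i<n. w i * l i) = (\<Sum>i<r. l i)" and gap: "(if r = n then 0 else l r) < l (r - 1)"
    and i: "i < n"
  have sd: "(\<Sum>i<n. d i) = 0" and sw: "c * (real r - (\<Sum>i<n. w i)) = 0"
    using eq slack dn e by linarith+
  have dz: "d i = 0" if "i < n" for i
    using sd d0 that by (subst (asm) sum_nonneg_eq_0_iff) auto
  have low: "w i = 0" if "i < n" "\<not> i < r" for i
  proof -
    from that have "l i \<le> l r" using l(1)[of r i] by (cases "i = r") auto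
    with gap that have "l i < c" by (auto simp: c_def split: if_splits)
    then show ?thesis using dz[OF that(1)] that by (simp add: d_def)
  qed
  have "c > 0" using gap l(2)[of r] r by (auto simp: c_def split: if_splits)
  with sw have "(\<Sum>i<n. w i) = real r" by simp
  moreover have "(\<Sum>i<n. w i) = (\<Sum>i<n. if i < r then w i else 0)"
    using low by (intro sum.cong) auto
  ultimately have "(\<Sum>i<r. 1 - w i) = 0" unfolding top by (simp add: sum_subtractf)
  then have "1 - w i = 0" if "i < r" for i
    using that w(2) r by (subst (asm) sum_nonneg_eq_0_iff) auto
  then show "w i = (if i < r then 1 else 0)" using low[OF i] by auto
qed

text \<open>
  For orthogonal U this is the orthogonal projection onto the span of the columns
  of U with index in S.
\<close>
definition coord_proj :: "real mat \<Rightarrow> nat set \<Rightarrow> real mat" where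
  "coord_proj U S = U * mat_diag (dim_col U) (indicator S) * U\<^sup>T"

lemma real_orthogonal_matD:
  assumes "real_orthogonal_mat n U"
  shows "U \<in> carrier_mat n n" "U\<^sup>T * U = 1\<^sub>m n" "U * U\<^sup>T = 1\<^sub>m n"
  using assms by (auto simp: real_orthogonal_mat_def)

lemma orthogonal_conj_cancel:
  fixes D :: "real mat"
  assumes U: "real_orthogonal_mat n U" and D: "D \<in> carrier_mat n n"
  shows "U * (U\<^sup>T * D * U) * U\<^sup>T = D" "U\<^sup>T * (U * D * U\<^sup>T) * U = D"
proof -
  note u = real_orthogonal_matD[OF U]
  have "U * (U\<^sup>T * D * U) * U\<^sup>T = (U * U\<^sup>T) * D * (U * U\<^sup>T)"
    using u(1) D by (simp add: assoc_mult_mat[of _ n n _ n _ n])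
  then show "U * (U\<^sup>T * D * U) * U\<^sup>T = D" using D u by simp
  have "U\<^sup>T * (U * D * U\<^sup>T) * U = (U\<^sup>T * U) * D * (U\<^sup>T * U)"
    using u(1) D by (simp add: assoc_mult_mat[of _ n n _ n _ n])
  then show "U\<^sup>T * (U * D * U\<^sup>T) * U = D" using D u by simp
qed

lemma orthogonal_conj_mult:
  fixes D :: "real mat"
  assumes U: "real_orthogonal_mat n U" and D: "D \<in> carrier_mat n n" "D' \<in> carrier_mat n n"
  shows "(U * D * U\<^sup>T) * (U * D' * U\<^sup>T) = U * (D * D') * U\<^sup>T"
proof -
  note u = real_orthogonal_matD[OF U]
  have "(U * D * U\<^sup>T) * (U * D' * U\<^sup>T) = U * D * (U\<^sup>T * U) * (D' * U\<^sup>T)"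
    using u(1) D by (simp add: assoc_mult_mat[of _ n n _ n _ n])
  then show ?thesis using u D by (simp add: assoc_mult_mat[of _ n n _ n _ n])
qed

lemma real_orthogonal_mat_transpose:
  "real_orthogonal_mat n U \<Longrightarrow> real_orthogonal_mat n U\<^sup>T"
  by (auto simp: real_orthogonal_mat_def)

lemma orth_proj_conj:
  assumes U: "real_orthogonal_mat n U" and E: "orth_proj n E"
  shows "orth_proj n (U * E * U\<^sup>T)"
proof -
  note u = real_orthogonal_matD[OF U] and e = orth_projD[OF E]
  have "(U * E * U\<^sup>T)\<^sup>T = U * E * U\<^sup>T"
    using u(1) e(1,2) by (simp add: transpose_mult[of _ n n _ n] assoc_mult_mat[of _ n n _ n _ n])
  then show ?thesis
    using u(1) e(1,3) orthogonal_conj_mult[OF U e(1) e(1)] unfolding orth_proj_def by auto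
qed

lemma orth_proj_mat_diag_indicator: "orth_proj n (mat_diag n (indicator S))"
proof -
  have "(mat_diag n (indicator S))\<^sup>T = (mat_diag n (indicator S) :: real mat)"
    by (intro eq_matI) (auto simp: mat_diag_def)
  then show ?thesis
    by (simp add: orth_proj_def indicator_inter_arith[symmetric])
qed

lemma orth_proj_coord_proj:
  assumes U: "real_orthogonal_mat n U"
  shows "orth_proj n (coord_proj U S)"
  using orth_proj_conj[OF U orth_proj_mat_diag_indicator[of n S]] real_orthogonal_matD(1)[OF U]
  by (simp add: coord_proj_def)

text \<open>
  In the eigenbasis the trace only sees the diagonal entries of the conjugated
  projection, which are the weights of the linear program above.
\<close>
lemma mat_trace_mult_spectral:
  assumes U: "real_orthogonal_mat n U" and E: "E \<in> carrier_mat n n"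
  shows "mat_trace (E * (U * mat_diag n l * U\<^sup>T)) = (\<Sum>i<n. (U\<^sup>T * E * U) $$ (i, i) * l i)"
proof -
  note u = real_orthogonal_matD(1)[OF U]
  have "mat_trace (E * (U * mat_diag n l * U\<^sup>T)) = mat_trace ((E * U * mat_diag n l) * U\<^sup>T)"
    using u E by (simp add: assoc_mult_mat[of _ n n _ n _ n])
  also have "\<dots> = mat_trace (U\<^sup>T * (E * U * mat_diag n l))"
    using u E by (intro mat_trace_comm[of _ n n] mult_carrier_mat[of _ n n _ n]) auto
  also have "U\<^sup>T * (E * U * mat_diag n l) = (U\<^sup>T * E * U) * mat_diag n l"
    using u E by (simp add: assoc_mult_mat[of _ n n _ n _ n])
  also have "\<dots> = mat n n (\<lambda>(i, j). (U\<^sup>T * E * U) $$ (i, j) * l j)"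
    using u E by (intro mat_diag_mult_right) auto
  finally show ?thesis by (simp add: mat_trace_def)
qed

lemma ky_fan_orth_proj:
  assumes U: "real_orthogonal_mat n U" and E: "orth_proj n E" and tr: "mat_trace E \<le> real r"
    and r: "0 < r" "r \<le> n"
    and l: "\<And>i j. j < i \<Longrightarrow> i < n \<Longrightarrow> l i \<le> l j" "\<And>i. i < n \<Longrightarrow> 0 \<le> l i"
  shows "mat_trace (E * (U * mat_diag n l * U\<^sup>T)) \<le> (\<Sum>i<r. l i)"
    and "mat_trace (E * (U * mat_diag n l * U\<^sup>T)) = (\<Sum>i<r. l i) \<Longrightarrow>
      (if r = n then 0 else l r) < l (r - 1) \<Longrightarrow> E = coord_proj U {..<r}"
proof -
  note u = real_orthogonal_matD[OF U] and e = orth_projD[OF E]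
  define W where "W = U\<^sup>T * E * U"
  have W: "orth_proj n W"
    using orth_proj_conj[OF real_orthogonal_mat_transpose[OF U] E] by (simp add: W_def)
  have "mat_trace W = mat_trace (U * (U\<^sup>T * E))"
    unfolding W_def using u(1) e(1) by (intro mat_trace_comm[of _ n n]) auto
  also have "U * (U\<^sup>T * E) = U * U\<^sup>T * E"
    using u(1) e(1) by (simp add: assoc_mult_mat[of _ n n _ n _ n])
  finally have "mat_trace W = mat_trace E" using u e by simp
  then have trW: "(\<Sum>i<n. W $$ (i, i)) \<le> real r"
    using tr orth_projD(1)[OF W] by (simp add: mat_trace_def)
  note top = weighted_sum_le_top[where w = "\<lambda>i. W $$ (i, i)" and l = l,
    OF r orth_proj_diag_bounds[OF W] trW l]
  have eq: "mat_trace (E * (U * mat_diag n l * U\<^sup>T)) = (\<Sum>i<n. W $$ (i, i) * l i)"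
    using mat_trace_mult_spectral[OF U e(1)] by (simp add: W_def)
  show "mat_trace (E * (U * mat_diag n l * U\<^sup>T)) \<le> (\<Sum>i<r. l i)"
    unfolding eq using top(1) by blast
  assume "mat_trace (E * (U * mat_diag n l * U\<^sup>T)) = (\<Sum>i<r. l i)"
    and "(if r = n then 0 else l r) < l (r - 1)"
  then have "W $$ (i, i) = indicator {..<r} i" if "i < n" for i
    using top(2)[of i] that unfolding eq by (simp add: indicator_def)
  then have "W = mat_diag n (indicator {..<r})"
    by (intro orth_proj_diag_01[OF W]) (auto simp: indicator_def)
  then show "E = coord_proj U {..<r}"
    using orthogonal_conj_cancel(1)[OF U e(1)] u(1) by (simp add: coord_proj_def W_def)
qed

lemma mat_trace_coord_proj_mult_spectral:
  assumes U: "real_orthogonal_mat n U" and S: "S \<subseteq> {..<n}"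
  shows "mat_trace (coord_proj U S * (U * mat_diag n l * U\<^sup>T)) = (\<Sum>i\<in>S. l i)"
proof -
  note u = real_orthogonal_matD(1)[OF U]
  have "U\<^sup>T * coord_proj U S * U = mat_diag n (indicator S)"
    using orthogonal_conj_cancel(2)[OF U, of "mat_diag n (indicator S)"] u by (simp add: coord_proj_def)
  then have "mat_trace (coord_proj U S * (U * mat_diag n l * U\<^sup>T)) = (\<Sum>i<n. indicator S i * l i)"
    using mat_trace_mult_spectral[OF U orth_projD(1)[OF orth_proj_coord_proj[OF U]]]
    by (simp add: mat_diag_def)
  also have "\<dots> = (\<Sum>i\<in>S. l i)"
    using S by (simp add: indicator_def sum.If_cases Int_absorb1 if_distrib[of "\<lambda>x. x * _"] cong: if_cong)
  finally show ?thesis .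
qed

text \<open>
  The product is a sum of one outer product, of a column of V with a row of W, for
  each index in S; rank is subadditive and an outer product has rank at most one.
\<close>
lemma rank_mult_diag_indicator_le:
  fixes V W :: "real mat"
  assumes V: "V \<in> carrier_mat n q" and W: "W \<in> carrier_mat q m" and "finite S"
  shows "vec_space.rank n (V * mat_diag q (indicator S) * W) \<le> card S"
  using \<open>finite S\<close>
proof (induction S)
  case empty
  have "mat_diag q (indicator {}) = (0\<^sub>m q q :: real mat)"
    by (intro eq_matI) (auto simp: mat_diag_def)
  then have "V * mat_diag q (indicator {}) * W = 0\<^sub>m n m"
    using V W by (simp only:) simp
  then show ?case by (simp only: vec_space.rank_0I)
next
  case (insert i S)
  let ?T = "\<lambda>S. V * mat_diag q (indicator S) * W"
  have T: "?T S \<in> carrier_mat n m" for S using V W by auto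
  have "mat_diag q (indicator (insert i S)) = (mat_diag q (indicator {i}) + mat_diag q (indicator S) :: real mat)"
    using insert.hyps by (intro eq_matI) (auto simp: mat_diag_def indicator_def)
  then have split: "?T (insert i S) = ?T {i} + ?T S"
    using V W by (simp add: mult_add_distrib_mat[of _ n q _ q] add_mult_distrib_mat[of _ n q _ _ m])
  have entry: "?T {i} $$ (a, b) = (if i < q then V $$ (a, i) else 0) * (if i < q then W $$ (i, b) else 0)"
    if "a < n" "b < m" for a b
  proof -
    have "?T {i} $$ (a, b) = (\<Sum>j<q. V $$ (a, j) * indicator {i} j * W $$ (j, b))"
      using that V W
      by (subst mat_diag_mult_right[OF V]) (auto simp: scalar_prod_def atLeast0LessThan intro!: sum.cong)
    also have "\<dots> = (\<Sum>j<q. if j = i then V $$ (a, j) * W $$ (j, b) else 0)"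
      by (intro sum.cong) auto
    finally show ?thesis by simp
  qed
  have "vec_space.rank n (?T {i}) \<le> 1"
    by (rule vec_space.rank_le_1_product_entries[OF T[of "{i}"]]) (use entry V W in auto)
  then have "vec_space.rank n (?T (insert i S)) \<le> 1 + vec_space.rank n (?T S)"
    unfolding split using vec_space.rank_subadditive[OF T[of "{i}"] T[of S]] by linarith
  with insert show ?case by simp
qed

lemma rank_coord_proj_mult_le:
  assumes U: "real_orthogonal_mat n U" and X: "X \<in> carrier_mat n m" and "finite S"
  shows "vec_space.rank n (coord_proj U S * X) \<le> card S"
proof -
  note u = real_orthogonal_matD(1)[OF U]
  have "coord_proj U S * X = U * mat_diag n (indicator S) * (U\<^sup>T * X)"
    using u X by (simp add: coord_proj_def assoc_mult_mat[of _ n n _ n _ m])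
  then show ?thesis using rank_mult_diag_indicator_le[OF u _ assms(3), of "U\<^sup>T * X" m] u X by simp
qed

lemma first_cols_mult_transpose:
  assumes U: "real_orthogonal_mat n U" and r: "r \<le> n"
  shows "first_cols r U * (first_cols r U)\<^sup>T = coord_proj U {..<r}"
proof (rule eq_matI)
  note u = real_orthogonal_matD(1)[OF U]
  have fc: "first_cols r U \<in> carrier_mat n r" using u r by (auto simp: first_cols_def)
  have fe: "first_cols r U $$ (i, j) = U $$ (i, j)" if "i < n" "j < r" for i j
    using that u r by (auto simp: first_cols_def mat_of_cols_index)
  show "dim_row (first_cols r U * (first_cols r U)\<^sup>T) = dim_row (coord_proj U {..<r})"
    "dim_col (first_cols r U * (first_cols r U)\<^sup>T) = dim_col (coord_proj U {..<r})"
    using fc u by (auto simp: coord_proj_def)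
  fix i j assume "i < dim_row (coord_proj U {..<r})" "j < dim_col (coord_proj U {..<r})"
  then have ij: "i < n" "j < n" using u by (auto simp: coord_proj_def)
  have "(first_cols r U * (first_cols r U)\<^sup>T) $$ (i, j) = (\<Sum>k<r. U $$ (i, k) * U $$ (j, k))"
    using fc ij by (auto simp: scalar_prod_def fe atLeast0LessThan intro!: sum.cong)
  also have "\<dots> = (\<Sum>k<n. U $$ (i, k) * indicator {..<r} k * U $$ (j, k))"
    using r by (intro sum.mono_neutral_cong_left) (auto simp: indicator_def)
  also have "\<dots> = coord_proj U {..<r} $$ (i, j)"
    using ij u by (simp add: coord_proj_def, subst mat_diag_mult_right[OF u])
      (auto simp: scalar_prod_def atLeast0LessThan intro!: sum.cong)
  finally show "(first_cols r U * (first_cols r U)\<^sup>T) $$ (i, j) = coord_proj U {..<r} $$ (i, j)" .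
qed

section \<open>Gram matrices and their eigenvectors\<close>

lemma mat_add_diff_cancel:
  fixes X Y :: "'a::ab_group_add mat"
  assumes "X \<in> carrier_mat n m" "Y \<in> carrier_mat n m"
  shows "X + (Y - X) = Y"
  using assms by (intro eq_matI) auto

lemma mat_diff_add_diff:
  fixes X Y W :: "'a::ab_group_add mat"
  assumes "X \<in> carrier_mat n m" "Y \<in> carrier_mat n m" "W \<in> carrier_mat n m"
  shows "(X - Y) + (Y - W) = X - W"
  using assms by (intro eq_matI) auto

lemma frobenius_norm_minus_commute:
  assumes "X \<in> carrier_mat n m" "Y \<in> carrier_mat n m"
  shows "frobenius_norm (X - Y) = frobenius_norm (Y - X)"
  using assms by (simp add: frobenius_norm_def power2_commute)

text \<open>
  Pythagoras for the orthogonal splitting Y = E Y + (Y - E Y), together with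
  |E Y|^2 = trace (E Y Y^T E) = trace (E Y Y^T).
\<close>
lemma orth_proj_mult_frobenius:
  assumes E: "orth_proj n E" and Y: "Y \<in> carrier_mat n q"
  shows "(frobenius_norm (E * Y - Y))\<^sup>2 = (frobenius_norm Y)\<^sup>2 - mat_trace (E * (Y * Y\<^sup>T))"
proof -
  note e = orth_projD[OF E]
  have EY: "E * Y \<in> carrier_mat n q" and D: "Y - E * Y \<in> carrier_mat n q"
    using e(1) Y by auto
  have ED: "E * (Y - E * Y) = 0\<^sub>m n q"
  proof -
    have "E * (Y - E * Y) = E * Y - (E * E) * Y"
      using e(1) Y by (simp add: mult_minus_distrib_mat[of _ n n _ q] assoc_mult_mat[of _ n n _ n _ q])
    then show ?thesis using e Y by auto
  qed
  have "mat_trace (E * Y * (Y - E * Y)\<^sup>T) = mat_trace (E * (Y * (Y - E * Y)\<^sup>T))"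
    using e(1) Y D by (simp add: assoc_mult_mat[of _ n n _ q _ n])
  also have "\<dots> = mat_trace (Y * (Y - E * Y)\<^sup>T * E)"
    using e(1) Y D by (intro mat_trace_comm[of _ n n] mult_carrier_mat[of _ n q _ n]) auto
  also have "Y * (Y - E * Y)\<^sup>T * E = Y * (E * (Y - E * Y))\<^sup>T"
    using e(1,2) Y D by (simp add: transpose_mult[of _ n n _ q] assoc_mult_mat[of _ n q _ n _ n])
  also have "mat_trace \<dots> = 0" using Y by (simp add: ED mat_trace_def)
  finally have "(frobenius_norm (E * Y + (Y - E * Y)))\<^sup>2 =
      (frobenius_norm (E * Y))\<^sup>2 + (frobenius_norm (Y - E * Y))\<^sup>2"
    by (rule frobenius_pythagoras[OF EY D])
  moreover have "E * Y + (Y - E * Y) = Y" by (rule mat_add_diff_cancel[OF EY Y])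
  moreover have "(frobenius_norm (E * Y - Y))\<^sup>2 = (frobenius_norm (Y - E * Y))\<^sup>2"
    by (simp add: frobenius_norm_minus_commute[OF EY Y])
  moreover have "(frobenius_norm (E * Y))\<^sup>2 = mat_trace (E * (Y * Y\<^sup>T))"
  proof -
    have "(frobenius_norm (E * Y))\<^sup>2 = mat_trace (E * Y * (Y\<^sup>T * E))"
      using frobenius_norm_sq_trace[OF EY] e Y by (simp add: transpose_mult[of _ n n _ q])
    also have "E * Y * (Y\<^sup>T * E) = E * (Y * Y\<^sup>T * E)"
      using e(1) Y by (simp add: assoc_mult_mat[of _ n n _ q _ n] assoc_mult_mat[of _ n q _ n _ n])
    also have "mat_trace \<dots> = mat_trace (Y * Y\<^sup>T * E * E)"
      using e(1) Y by (intro mat_trace_comm[of _ n n] mult_carrier_mat[of _ n n _ n] mult_carrier_mat[of _ n q _ n]) auto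
    also have "Y * Y\<^sup>T * E * E = Y * Y\<^sup>T * (E * E)"
      using e(1) Y by (intro assoc_mult_mat[of _ n n _ n _ n] mult_carrier_mat[of _ n q _ n]) auto
    also have "mat_trace (Y * Y\<^sup>T * (E * E)) = mat_trace (Y * Y\<^sup>T * E)" by (simp only: e(3))
    also have "\<dots> = mat_trace (E * (Y * Y\<^sup>T))"
      using e(1) Y by (intro mat_trace_comm[of _ n n] mult_carrier_mat[of _ n q _ n]) auto
    finally show ?thesis .
  qed
  ultimately show ?thesis by simp
qed

lemma coord_proj_mult:
  assumes U: "real_orthogonal_mat n U"
  shows "coord_proj U S * coord_proj U T = coord_proj U (S \<inter> T)"
proof -
  have "indicator (S \<inter> T) = (\<lambda>i. indicator S i * indicator T i :: real)"
    by (auto simp: indicator_def)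
  then show ?thesis
    using orthogonal_conj_mult[OF U, of "mat_diag n (indicator S)" "mat_diag n (indicator T)"]
      real_orthogonal_matD(1)[OF U]
    by (simp add: coord_proj_def)
qed

text \<open>
  Here l i is the squared norm of the i-th row of U^T Y. In particular eigenvalues
  of Y Y^T are nonnegative, and a zero eigenvalue annihilates the row.
\<close>
lemma gram_eigenvalue_sum:
  assumes U: "real_orthogonal_mat n U" and Y: "Y \<in> carrier_mat n q"
    and eig: "Y * Y\<^sup>T = U * mat_diag n l * U\<^sup>T" and i: "i < n"
  shows "l i = (\<Sum>j<q. ((U\<^sup>T * Y) $$ (i, j))\<^sup>2)"
proof -
  note u = real_orthogonal_matD(1)[OF U]
  define W where "W = U\<^sup>T * Y"
  have W: "W \<in> carrier_mat n q" using u Y by (auto simp: W_def)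
  have "mat_diag n l = U\<^sup>T * (Y * Y\<^sup>T) * U"
    unfolding eig using orthogonal_conj_cancel(2)[OF U, of "mat_diag n l"] by simp
  also have "\<dots> = (U\<^sup>T * Y) * (U\<^sup>T * Y)\<^sup>T"
    using u Y by (simp add: transpose_mult[of _ n n _ q] assoc_mult_mat[of _ n n _ q _ n]
        assoc_mult_mat[of _ n q _ n _ n] assoc_mult_mat[of _ n n _ n _ n])
  finally have gram: "mat_diag n l = W * W\<^sup>T" by (simp add: W_def)
  have "l i = mat_diag n l $$ (i, i)" using i by (simp add: mat_diag_def)
  also have "\<dots> = (\<Sum>j<q. (W $$ (i, j))\<^sup>2)"
    unfolding gram using W i by (simp add: scalar_prod_def power2_eq_square atLeast0LessThan)
  finally show ?thesis by (simp add: W_def)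
qed

lemma coord_proj_mult_gram:
  assumes U: "real_orthogonal_mat n U" and Y: "Y \<in> carrier_mat n q"
    and eig: "Y * Y\<^sup>T = U * mat_diag n l * U\<^sup>T"
    and z: "\<And>i. i < n \<Longrightarrow> i \<notin> S \<Longrightarrow> l i = 0"
  shows "coord_proj U S * Y = Y"
proof -
  note u = real_orthogonal_matD[OF U]
  define W where "W = U\<^sup>T * Y"
  have W: "W \<in> carrier_mat n q" using u Y by (auto simp: W_def)
  have row0: "W $$ (i, j) = 0" if "i < n" "i \<notin> S" "j < q" for i j
  proof -
    have "(\<Sum>j<q. (W $$ (i, j))\<^sup>2) = 0"
      using gram_eigenvalue_sum[OF U Y eig] z that unfolding W_def by metis
    then show ?thesis using that by (subst (asm) sum_nonneg_eq_0_iff) auto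
  qed
  have "mat_diag n (indicator S) * W = mat n q (\<lambda>(i, j). indicator S i * W $$ (i, j))"
    by (rule mat_diag_mult_left[OF W])
  also have "\<dots> = W"
    using row0 W by (intro eq_matI) (auto simp: indicator_def)
  finally have D: "mat_diag n (indicator S) * W = W" .
  have "coord_proj U S * Y = U * (mat_diag n (indicator S) * W)"
    using u(1) Y by (simp add: W_def coord_proj_def assoc_mult_mat[of _ n n _ n _ q])
  also have "\<dots> = U * U\<^sup>T * Y"
    unfolding D using u(1) Y by (simp add: W_def assoc_mult_mat[of _ n n _ n _ q])
  finally show ?thesis using u Y by simp
qed

section \<open>Least squares under a rank constraint\<close>

text \<open>
  The problem of minimizing |Z B - C| over Z, with an invertible Gram matrix
  B B^T whose inverse is Gi. Then K below is the solution without rank constraint.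
\<close>
locale matrix_regression =
  fixes n m q :: nat and B C Gi :: "real mat"
  assumes B: "B \<in> carrier_mat m q" and C: "C \<in> carrier_mat n q" and Gi: "Gi \<in> carrier_mat m m"
    and gram_inv: "B * B\<^sup>T * Gi = 1\<^sub>m m" "Gi * (B * B\<^sup>T) = 1\<^sub>m m"
begin

definition err :: "real mat \<Rightarrow> real" where
  "err Z = (frobenius_norm (Z * B - C))\<^sup>2"

definition K :: "real mat" where
  "K = C * B\<^sup>T * Gi"

lemma K: "K \<in> carrier_mat n m"
  using B C Gi by (auto simp: K_def)

lemma normal_equations: "K * (B * B\<^sup>T) = C * B\<^sup>T"
proof -
  have CB: "C * B\<^sup>T \<in> carrier_mat n m" using B C by auto
  have "K * (B * B\<^sup>T) = C * B\<^sup>T * (Gi * (B * B\<^sup>T))"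
    unfolding K_def using B Gi CB by (intro assoc_mult_mat[of _ n m _ m _ m]) auto
  then show ?thesis using right_mult_one_mat[OF CB] by (simp add: gram_inv)
qed

text \<open>
  X is recovered from X B by multiplication with B^T Gi; so a vanishing squared
  distance |(Z - E K) B|^2 determines Z.
\<close>
lemma mult_B_eq_0D:
  assumes X: "X \<in> carrier_mat n m" and z: "(frobenius_norm (X * B))\<^sup>2 = 0"
  shows "X = 0\<^sub>m n m"
proof -
  have "X * B = 0\<^sub>m n q" using X B by (intro frobenius_norm_sq_eq_0D[OF _ z]) auto
  moreover have "X * (B * B\<^sup>T * Gi) = X * B * B\<^sup>T * Gi"
    using X B Gi by (simp add: assoc_mult_mat[of _ n m _ q _ m] assoc_mult_mat[of _ n m _ m _ m])
  ultimately show ?thesis using X B Gi by (simp add: gram_inv)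
qed

text \<open>
  By the normal equations the residual K B - C is orthogonal to every X B.
\<close>
lemma err_eq:
  assumes Z: "Z \<in> carrier_mat n m"
  shows "err Z = (frobenius_norm ((Z - K) * B))\<^sup>2 + err K"
proof -
  have KB: "K * B \<in> carrier_mat n q" "K * B - C \<in> carrier_mat n q" using K B C by auto
  have ZK: "(Z - K) * B \<in> carrier_mat n q" using Z K B by auto
  have "(K * B - C) * B\<^sup>T = K * (B * B\<^sup>T) - C * B\<^sup>T"
    using K B C by (simp add: minus_mult_distrib_mat[of _ n q _ _ m] assoc_mult_mat[of _ n m _ q _ m])
  then have "(K * B - C) * B\<^sup>T = 0\<^sub>m n m" using B C by (simp add: normal_equations)
  then have "B * (K * B - C)\<^sup>T = 0\<^sub>m m n"
    using transpose_mult[of "K * B - C" n q "B\<^sup>T" m] KB B by simp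
  moreover have "(Z - K) * B * (K * B - C)\<^sup>T = (Z - K) * (B * (K * B - C)\<^sup>T)"
    using Z K B KB by (intro assoc_mult_mat[of _ n m _ q _ n]) auto
  ultimately have "mat_trace ((Z - K) * B * (K * B - C)\<^sup>T) = 0"
    using Z K by (simp add: mat_trace_def)
  from frobenius_pythagoras[OF ZK KB(2) this]
  have "(frobenius_norm ((Z - K) * B + (K * B - C)))\<^sup>2 = (frobenius_norm ((Z - K) * B))\<^sup>2 + err K"
    by (simp add: err_def)
  moreover have "(Z - K) * B + (K * B - C) = Z * B - C"
    unfolding minus_mult_distrib_mat[OF Z K B] using Z B KB(1) C
    by (intro mat_diff_add_diff[of _ n q]) auto
  ultimately show ?thesis by (simp add: err_def)
qed

text \<open>
  Writing Y = K B, the difference Z B - Y splits into (Z - E K) B = Z B - E Y, which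
  E fixes, and E Y - Y, which E annihilates. Only the first part depends on Z once
  E is chosen, and only the trace depends on E alone.
\<close>
lemma err_orth_proj:
  assumes Z: "Z \<in> carrier_mat n m" and E: "orth_proj n E" and EZ: "E * Z = Z"
  shows "err Z = (frobenius_norm ((Z - E * K) * B))\<^sup>2 + (err K + (frobenius_norm (K * B))\<^sup>2)
    - mat_trace (E * (K * B * (K * B)\<^sup>T))"
proof -
  note e = orth_projD[OF E]
  define Y where "Y = K * B"
  define X where "X = (Z - E * K) * B"
  define V where "V = E * Y - Y"
  have Y: "Y \<in> carrier_mat n q" using K B by (auto simp: Y_def)
  have EK: "E * K \<in> carrier_mat n m" using e(1) K by auto
  have X: "X \<in> carrier_mat n q" unfolding X_def by (rule mult_carrier_mat[OF minus_carrier_mat[OF EK] B])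
  have V: "V \<in> carrier_mat n q" unfolding V_def by (rule minus_carrier_mat[OF Y])
  have "E * X = E * (Z - E * K) * B"
    unfolding X_def by (rule assoc_mult_mat[OF e(1) minus_carrier_mat[OF EK] B, symmetric])
  also have "E * (Z - E * K) = E * Z - (E * E) * K"
    using e(1) Z K by (simp add: mult_minus_distrib_mat[of _ n n _ m] assoc_mult_mat[of _ n n _ n _ m])
  finally have EX: "E * X = X" by (simp add: EZ e X_def)
  have "E * V = (E * E) * Y - E * Y"
    unfolding V_def using e(1) Y by (simp add: mult_minus_distrib_mat[of _ n n _ q] assoc_mult_mat[of _ n n _ n _ q])
  then have EV: "E * V = 0\<^sub>m n q" using e Y by simp
  have "mat_trace (X * V\<^sup>T) = mat_trace (E * (X * V\<^sup>T))"
    using assoc_mult_mat[of E n n X q "V\<^sup>T" n] e(1) X V EX by simp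
  also have "\<dots> = mat_trace (X * V\<^sup>T * E)"
    using e(1) X V by (intro mat_trace_comm[of _ n n]) auto
  also have "X * V\<^sup>T * E = X * (E * V)\<^sup>T"
    using e(1,2) X V by (simp add: transpose_mult[of _ n n _ q] assoc_mult_mat[of _ n q _ n _ n])
  also have "mat_trace \<dots> = 0" using X by (simp add: EV mat_trace_def)
  finally have "(frobenius_norm (X + V))\<^sup>2 = (frobenius_norm X)\<^sup>2 + (frobenius_norm V)\<^sup>2"
    by (rule frobenius_pythagoras[OF X V])
  moreover have "X + V = (Z - K) * B"
    unfolding X_def V_def Y_def minus_mult_distrib_mat[OF Z K B] minus_mult_distrib_mat[OF Z EK B]
      assoc_mult_mat[OF e(1) K B]
    using Z e(1) K B by (intro mat_diff_add_diff[of _ n q]) auto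
  moreover have "(frobenius_norm V)\<^sup>2 = (frobenius_norm Y)\<^sup>2 - mat_trace (E * (Y * Y\<^sup>T))"
    unfolding V_def by (rule orth_proj_mult_frobenius[OF E Y])
  ultimately show ?thesis by (simp add: err_eq[OF Z] X_def Y_def)
qed

text \<open>
  The lower bound combines the error formula with Ky Fan's inequality for a
  projection that fixes Z. Both are tight for Zhat; conversely, a minimizer makes
  both tight, which under the gap forces the projection and then Z. The rank
  hypothesis serves to show l (r - 1) > 0: this rules out r = n in the absence of a
  gap and separates Zhat from the minimizer obtained by exchanging eigenvectors.
\<close>
lemma rank_constrained_minimizers:
  assumes U: "real_orthogonal_mat n U"
    and eig: "K * B * (K * B)\<^sup>T = U * mat_diag n l * U\<^sup>T"
    and l: "\<And>i j. j < i \<Longrightarrow> i < n \<Longrightarrow> l i \<le> l j"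
    and r: "0 < r" "r \<le> n" and rk: "r \<le> vec_space.rank n (C * B\<^sup>T)"
    and Zhat: "Zhat = coord_proj U {..<r} * K"
  shows "is_arg_min err (\<lambda>Z. Z \<in> rank_at_most n m r) Zhat"
    and "(\<forall>Z. is_arg_min err (\<lambda>Z. Z \<in> rank_at_most n m r) Z \<longleftrightarrow> Z = Zhat) \<longleftrightarrow>
      (if r = n then 0 else l r) < l (r - 1)"
proof -
  define c where "c = err K + (frobenius_norm (K * B))\<^sup>2"
  have Y: "K * B \<in> carrier_mat n q" using K B by auto
  have l0: "0 \<le> l i" if "i < n" for i
    using gram_eigenvalue_sum[OF U Y eig that] by (simp add: sum_nonneg)
  have cp: "orth_proj n (coord_proj U S)" for S by (rule orth_proj_coord_proj[OF U])
  note cpc = orth_projD(1)[OF cp]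
  have feas: "coord_proj U S * K \<in> rank_at_most n m r" if "finite S" "card S \<le> r" for S
    using rank_coord_proj_mult_le[OF U K that(1)] that(2) K cpc[of S]
    by (auto simp: rank_at_most_def)
  have val: "err (coord_proj U S * K) = c - (\<Sum>i\<in>S. l i)" if S: "S \<subseteq> {..<n}" for S
  proof -
    have "coord_proj U S * (coord_proj U S * K) = coord_proj U S * K"
      using assoc_mult_mat[OF cpc cpc K, of S S] by (simp add: coord_proj_mult[OF U])
    moreover have "coord_proj U S * K \<in> carrier_mat n m" by (rule mult_carrier_mat[OF cpc K])
    moreover from this have "coord_proj U S * K - coord_proj U S * K = 0\<^sub>m n m" by simp
    ultimately show ?thesis
      using err_orth_proj[OF _ cp, of "coord_proj U S * K" S] B
      by (simp add: eig mat_trace_coord_proj_mult_spectral[OF U S] c_def frobenius_norm_def)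
  qed
  have bound: "c - (\<Sum>i<r. l i) \<le> err Z \<and> (err Z = c - (\<Sum>i<r. l i) \<longrightarrow>
      (if r = n then 0 else l r) < l (r - 1) \<longrightarrow> Z = Zhat)" if feasible: "Z \<in> rank_at_most n m r" for Z
  proof -
    from feasible have Z: "Z \<in> carrier_mat n m" "vec_space.rank n Z \<le> r"
      by (auto simp: rank_at_most_def)
    obtain E where E: "orth_proj n E" "mat_trace E \<le> real (vec_space.rank n Z)" "E * Z = Z"
      by (rule orth_proj_of_rank[OF Z(1)])
    have tr: "mat_trace E \<le> real r" using E(2) Z(2) by linarith
    note kf = ky_fan_orth_proj[where l = l, OF U E(1) tr r l l0]
    have eq: "err Z = (frobenius_norm ((Z - E * K) * B))\<^sup>2 + c
        - mat_trace (E * (U * mat_diag n l * U\<^sup>T))"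
      using err_orth_proj[OF Z(1) E(1,3)] by (simp add: c_def eig)
    have sq: "0 \<le> (frobenius_norm ((Z - E * K) * B))\<^sup>2" by simp
    have kf1: "mat_trace (E * (U * mat_diag n l * U\<^sup>T)) \<le> (\<Sum>i<r. l i)"
      using kf(1) by blast
    have "Z = Zhat" if e: "err Z = c - (\<Sum>i<r. l i)" and gap: "(if r = n then 0 else l r) < l (r - 1)"
    proof -
      have tight: "mat_trace (E * (U * mat_diag n l * U\<^sup>T)) = (\<Sum>i<r. l i)"
        and z: "(frobenius_norm ((Z - E * K) * B))\<^sup>2 = 0"
        using eq sq kf1 e by linarith+
      have E_eq: "E = coord_proj U {..<r}" using kf(2) tight gap by blast
      have EK: "E * K \<in> carrier_mat n m" using orth_projD(1)[OF E(1)] K by auto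
      have D: "Z - E * K = 0\<^sub>m n m" by (rule mult_B_eq_0D[OF minus_carrier_mat[OF EK] z])
      have "Z = E * K + (Z - E * K)" by (rule mat_add_diff_cancel[OF EK Z(1), symmetric])
      also have "\<dots> = E * K" using EK by (simp add: D)
      finally show ?thesis by (simp add: Zhat E_eq)
    qed
    moreover have "c - (\<Sum>i<r. l i) \<le> err Z" using eq sq kf1 by linarith
    ultimately show ?thesis by blast
  qed
  have Zhat_val: "err Zhat = c - (\<Sum>i<r. l i)" using val[of "{..<r}"] r by (simp add: Zhat)
  have Zhat_feas: "Zhat \<in> rank_at_most n m r" using feas[of "{..<r}"] by (simp add: Zhat)
  have min_iff: "is_arg_min err (\<lambda>Z. Z \<in> rank_at_most n m r) Z \<longleftrightarrow>
      Z \<in> rank_at_most n m r \<and> err Z = c - (\<Sum>i<r. l i)" for Z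
    using bound Zhat_val Zhat_feas unfolding is_arg_min_def by (metis less_le_not_le not_le order_antisym)
  show "is_arg_min err (\<lambda>Z. Z \<in> rank_at_most n m r) Zhat"
    using min_iff Zhat_val Zhat_feas by blast
  \<comment> \<open>Otherwise r - 1 eigenvectors carry all of K B, and with it C B^T.\<close>
  have pos: "0 < l (r - 1)"
  proof (rule ccontr)
    assume "\<not> 0 < l (r - 1)"
    then have "l i = 0" if "i < n" "i \<notin> {..<r - 1}" for i
      using l[of "r - 1" i] l0[of i] that by (cases "i = r - 1") auto
    then have "coord_proj U {..<r - 1} * (K * B) = K * B"
      by (intro coord_proj_mult_gram[OF U Y eig]) auto
    then have "C * B\<^sup>T = coord_proj U {..<r - 1} * (K * B) * B\<^sup>T"
      using K B by (simp add: assoc_mult_mat[of _ n m _ q _ m] normal_equations)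
    also have "\<dots> = coord_proj U {..<r - 1} * (K * B * B\<^sup>T)"
      using cpc Y B by (intro assoc_mult_mat[of _ n n _ q _ m]) auto
    finally have "vec_space.rank n (C * B\<^sup>T) \<le> r - 1"
      using rank_coord_proj_mult_le[OF U, of "K * B * B\<^sup>T" m "{..<r - 1}"] Y B by simp
    then show False using rk r by simp
  qed
  show "(\<forall>Z. is_arg_min err (\<lambda>Z. Z \<in> rank_at_most n m r) Z \<longleftrightarrow> Z = Zhat) \<longleftrightarrow>
      (if r = n then 0 else l r) < l (r - 1)" (is "?L = ?R")
  proof
    assume ?R
    then show ?L using min_iff bound Zhat_val Zhat_feas by blast
  next
    assume L: ?L
    show ?R
    proof (rule ccontr)
      assume "\<not> ?R"
      then have rn: "r < n" and ge: "l (r - 1) \<le> l r" using pos r by (auto split: if_splits)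
      have eq: "l r = l (r - 1)" using l[of "r - 1" r] r rn ge by auto
      \<comment> \<open>Indices start at 0: eigenvector r replaces the equally good eigenvector r - 1.\<close>
      define S where "S = insert r {..<r - 1}"
      have "card S = r" using r by (simp add: S_def)
      then have S: "finite S" "card S \<le> r" "S \<subseteq> {..<n}" using rn by (auto simp: S_def)
      have "(\<Sum>i\<in>S. l i) = l (r - 1) + (\<Sum>i<r - 1. l i)" by (simp add: S_def eq)
      also have "\<dots> = (\<Sum>i<r. l i)" using r by (cases r) auto
      finally have "coord_proj U S * K = Zhat"
        using L min_iff feas[OF S(1,2)] val[OF S(3)] by metis
      \<comment> \<open>If both minimizers agreed, projecting them to eigenvector r would show
        that this eigenvector contributes nothing, that is, l r = 0.\<close>
      then have "coord_proj U {r} * (coord_proj U S * K) = coord_proj U {r} * (coord_proj U {..<r} * K)"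
        by (simp add: Zhat)
      then have "coord_proj U ({r} \<inter> S) * K = coord_proj U ({r} \<inter> {..<r}) * K"
        using assoc_mult_mat[OF cpc cpc K, of "{r}" S] assoc_mult_mat[OF cpc cpc K, of "{r}" "{..<r}"]
        by (simp add: coord_proj_mult[OF U])
      moreover have "{r} \<inter> S = {r}" "{r} \<inter> {..<r} = {}" by (auto simp: S_def)
      ultimately have "coord_proj U {r} * K = coord_proj U {} * K" by simp
      \<comment> \<open>The error formula distinguishes the two projections by the eigenvalue.\<close>
      then have "c - (\<Sum>i\<in>{r}. l i) = c - (\<Sum>i\<in>{}. l i)"
        using val[of "{r}"] val[of "{}"] rn by simp
      then show False using eq pos by simp
    qed
  qed
qed

end

section \<open>The block matrices of the problem\<close>

lemma sum_lessThan_add: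
  fixes g :: "nat \<Rightarrow> real"
  shows "(\<Sum>i<a + b. g i) = (\<Sum>i<a. g i) + (\<Sum>i<b. g (a + i))"
  by (induction b) auto

lemma hconcat_carrier:
  assumes "X \<in> carrier_mat n a" "Y \<in> carrier_mat n b"
  shows "hconcat X Y \<in> carrier_mat n (a + b)"
  using assms by (auto simp: hconcat_def)

lemma hconcat_mult_transpose:
  fixes X Y X' Y' :: "real mat"
  assumes "X \<in> carrier_mat n a" "Y \<in> carrier_mat n b" "X' \<in> carrier_mat m a" "Y' \<in> carrier_mat m b"
  shows "hconcat X Y * (hconcat X' Y')\<^sup>T = X * X'\<^sup>T + Y * Y'\<^sup>T"
  using assms by (intro eq_matI)
    (auto simp: hconcat_def scalar_prod_def atLeast0LessThan sum_lessThan_add)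

lemma mat_inv_of_det:
  fixes A :: "'a::field mat"
  assumes A: "A \<in> carrier_mat n n" and d: "det A \<noteq> 0"
  shows "mat_inv A \<in> carrier_mat n n" "A * mat_inv A = 1\<^sub>m n" "mat_inv A * A = 1\<^sub>m n"
proof -
  obtain X where "mat_inverse A = Some X"
    using mat_inverse(1)[OF A, of "()"] det_non_zero_imp_unit[OF A d, of "()"]
    by (cases "mat_inverse A") auto
  with mat_inverse(2)[OF A this]
  show "mat_inv A \<in> carrier_mat n n" "A * mat_inv A = 1\<^sub>m n" "mat_inv A * A = 1\<^sub>m n"
    by (auto simp: mat_inv_def)
qed

text \<open>
  For a kernel vector v, pairing with v gives |N^T v|^2 + \<eta>^2 |v|^2 = 0. The second
  term forces v = 0 if \<eta> is not zero; otherwise injectivity of N^T is needed.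
\<close>
lemma det_regularized_gram:
  fixes N :: "real mat"
  assumes N: "N \<in> carrier_mat m p"
    and inj: "\<And>v. \<eta> = 0 \<Longrightarrow> v \<in> carrier_vec m \<Longrightarrow> N\<^sup>T *\<^sub>v v = 0\<^sub>v p \<Longrightarrow> v = 0\<^sub>v m"
  shows "det (N * N\<^sup>T + \<eta>\<^sup>2 \<cdot>\<^sub>m 1\<^sub>m m) \<noteq> 0"
proof
  assume "det (N * N\<^sup>T + \<eta>\<^sup>2 \<cdot>\<^sub>m 1\<^sub>m m) = 0"
  then obtain v where v: "v \<in> carrier_vec m" "v \<noteq> 0\<^sub>v m"
    and 0: "(N * N\<^sup>T + \<eta>\<^sup>2 \<cdot>\<^sub>m 1\<^sub>m m) *\<^sub>v v = 0\<^sub>v m"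
    using det_0_iff_vec_prod_zero[of "N * N\<^sup>T + \<eta>\<^sup>2 \<cdot>\<^sub>m 1\<^sub>m m" m] N by auto
  define u where "u = N\<^sup>T *\<^sub>v v"
  have u: "u \<in> carrier_vec p" using N v by (auto simp: u_def)
  have "(N * N\<^sup>T + \<eta>\<^sup>2 \<cdot>\<^sub>m 1\<^sub>m m) *\<^sub>v v = N *\<^sub>v u + \<eta>\<^sup>2 \<cdot>\<^sub>v v"
  proof -
    have "(\<eta>\<^sup>2 \<cdot>\<^sub>m 1\<^sub>m m) *\<^sub>v v = \<eta>\<^sup>2 \<cdot>\<^sub>v v"
      using v(1) by (intro eq_vecI) auto
    then show ?thesis
      using N v by (simp add: u_def add_mult_distrib_mat_vec[of _ m m] assoc_mult_mat_vec[of _ m p _ m])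
  qed
  then have "v \<bullet> (N *\<^sub>v u + \<eta>\<^sup>2 \<cdot>\<^sub>v v) = 0" using 0 v(1) by (metis scalar_prod_right_zero)
  moreover have "v \<bullet> (N *\<^sub>v u + \<eta>\<^sup>2 \<cdot>\<^sub>v v) = v \<bullet> (N *\<^sub>v u) + \<eta>\<^sup>2 * (v \<bullet> v)"
    using N u v by (subst scalar_prod_add_distrib[of _ m]) auto
  moreover have "v \<bullet> (N *\<^sub>v u) = u \<bullet> u"
    using transpose_vec_mult_scalar[OF N u v(1)] by (simp add: u_def)
  moreover have "0 \<le> u \<bullet> u" "0 < v \<bullet> v"
    using conjugate_square_ge_0_vec[of u] conjugate_square_greater_0_vec[OF v(1)] v(2) by simp_all
  ultimately have "u \<bullet> u = 0" "\<eta>\<^sup>2 * (v \<bullet> v) = 0"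
    by (smt (verit) zero_le_power2 mult_nonneg_nonneg)+
  with \<open>0 < v \<bullet> v\<close> have "\<eta> = 0" "u = 0\<^sub>v p"
    using conjugate_square_eq_0_vec[OF u] by auto
  then show False using inj v by (simp add: u_def)
qed

theorem theorem3p3:
  fixes m n p k r :: nat
    and A M P F G H U Zhat :: "real mat"
    and \<eta> :: real
    and lam :: "nat \<Rightarrow> real"
    and f :: "real mat \<Rightarrow> real"
  assumes A: "A \<in> carrier_mat m n"
    and M: "M \<in> carrier_mat n p"
    and P: "P \<in> carrier_mat n m"
    and rank_A: "vec_space.rank m A = k" and "k \<le> n" and "n \<le> m"
    and rank_M: "vec_space.rank n M = n" and "n \<le> p"
    and "0 < r" and "r \<le> k"
    and "\<eta> \<ge> 0" and "r < m \<Longrightarrow> \<eta> \<noteq> 0"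
    and F: "F = (1\<^sub>m n - P * A) * M * M\<^sup>T * A\<^sup>T - \<eta>\<^sup>2 \<cdot>\<^sub>m P"
    and G: "G = A * M * M\<^sup>T * A\<^sup>T + \<eta>\<^sup>2 \<cdot>\<^sub>m 1\<^sub>m m"
    and H: "H = F * mat_inv G * F\<^sup>T"
    and f: "f = (\<lambda>Z. (frobenius_norm
              (Z * hconcat (A * M) (\<eta> \<cdot>\<^sub>m 1\<^sub>m m)
               - hconcat (M - P * A * M) ((- \<eta>) \<cdot>\<^sub>m P)))\<^sup>2)"
    and rank_F: "vec_space.rank n F \<ge> r"
    and U: "real_orthogonal_mat n U"
    and H_decomp: "H = U * mat_diag n (\<lambda>i. lam (Suc i)) * U\<^sup>T"
    and lam_ordered: "\<And>i j. 1 \<le> j \<Longrightarrow> j < i \<Longrightarrow> i \<le> n \<Longrightarrow> lam j \<ge> lam i"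
    and Zhat: "Zhat = first_cols r U * (first_cols r U)\<^sup>T * F * mat_inv G"
  shows "is_arg_min f (\<lambda>Z. Z \<in> rank_at_most n m r) Zhat \<and>
    ((\<forall>Z. is_arg_min f (\<lambda>Z. Z \<in> rank_at_most n m r) Z \<longleftrightarrow> Z = Zhat) \<longleftrightarrow>
     lam r > (if r = n then 0 else lam (Suc r)))"
proof -
  define N where "N = A * M"
  define B where "B = hconcat N (\<eta> \<cdot>\<^sub>m 1\<^sub>m m)"
  define C where "C = hconcat (M - P * A * M) ((- \<eta>) \<cdot>\<^sub>m P)"
  define Gi where "Gi = mat_inv G"
  have N: "N \<in> carrier_mat m p" using A M by (auto simp: N_def)
  have PA: "P * A \<in> carrier_mat n n" by (rule mult_carrier_mat[OF P A])
  have PAM: "P * A * M \<in> carrier_mat n p" by (rule mult_carrier_mat[OF PA M])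
  have NT: "N\<^sup>T = M\<^sup>T * A\<^sup>T" unfolding N_def by (rule transpose_mult[OF A M])
  have \<eta>I: "\<eta> \<cdot>\<^sub>m 1\<^sub>m m \<in> carrier_mat m m" by simp
  have MPAM: "M - P * A * M \<in> carrier_mat n p" by (rule minus_carrier_mat[OF PAM])
  have \<eta>P: "(- \<eta>) \<cdot>\<^sub>m P \<in> carrier_mat n m" using P by (rule smult_carrier_mat)
  have B: "B \<in> carrier_mat m (p + m)" unfolding B_def by (rule hconcat_carrier[OF N \<eta>I])
  have C: "C \<in> carrier_mat n (p + m)" unfolding C_def by (rule hconcat_carrier[OF MPAM \<eta>P])
  have MT: "M\<^sup>T \<in> carrier_mat p n" and AT: "A\<^sup>T \<in> carrier_mat n m" using M A by simp_all
  have GN: "G = N * N\<^sup>T + \<eta>\<^sup>2 \<cdot>\<^sub>m 1\<^sub>m m"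
    unfolding G NT N_def[symmetric] assoc_mult_mat[OF N MT AT] ..
  have BB: "B * B\<^sup>T = G"
  proof -
    have "B * B\<^sup>T = N * N\<^sup>T + \<eta> \<cdot>\<^sub>m 1\<^sub>m m * (\<eta> \<cdot>\<^sub>m 1\<^sub>m m)\<^sup>T"
      unfolding B_def by (rule hconcat_mult_transpose[OF N \<eta>I N \<eta>I])
    also have "\<eta> \<cdot>\<^sub>m 1\<^sub>m m * (\<eta> \<cdot>\<^sub>m 1\<^sub>m m)\<^sup>T = \<eta>\<^sup>2 \<cdot>\<^sub>m 1\<^sub>m m"
      by (intro eq_matI) (auto simp: scalar_prod_def power2_eq_square if_distrib cong: if_cong)
    finally show ?thesis by (simp add: GN)
  qed
  have CB: "C * B\<^sup>T = F"
  proof -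
    have "C * B\<^sup>T = (M - P * A * M) * N\<^sup>T + (- \<eta>) \<cdot>\<^sub>m P * (\<eta> \<cdot>\<^sub>m 1\<^sub>m m)\<^sup>T"
      unfolding B_def C_def by (rule hconcat_mult_transpose[OF MPAM \<eta>P N \<eta>I])
    also have "(- \<eta>) \<cdot>\<^sub>m P * (\<eta> \<cdot>\<^sub>m 1\<^sub>m m)\<^sup>T = - (\<eta>\<^sup>2 \<cdot>\<^sub>m P)"
    proof -
      have "(\<eta> \<cdot>\<^sub>m 1\<^sub>m m)\<^sup>T = \<eta> \<cdot>\<^sub>m (1\<^sub>m m :: real mat)" by (intro eq_matI) auto
      then have "(- \<eta>) \<cdot>\<^sub>m P * (\<eta> \<cdot>\<^sub>m 1\<^sub>m m)\<^sup>T = \<eta> \<cdot>\<^sub>m ((- \<eta>) \<cdot>\<^sub>m P)"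
        by (simp only: mult_smult_distrib[OF \<eta>P one_carrier_mat] right_mult_one_mat[OF \<eta>P])
      also have "\<dots> = - (\<eta>\<^sup>2 \<cdot>\<^sub>m P)" by (intro eq_matI) (auto simp: power2_eq_square)
      finally show ?thesis .
    qed
    also have "M - P * A * M = (1\<^sub>m n - P * A) * M"
      by (simp only: minus_mult_distrib_mat[OF one_carrier_mat PA M] left_mult_one_mat[OF M])
    also have "(1\<^sub>m n - P * A) * M * N\<^sup>T = (1\<^sub>m n - P * A) * M * M\<^sup>T * A\<^sup>T"
      unfolding NT
      by (rule assoc_mult_mat[OF mult_carrier_mat[OF minus_carrier_mat[OF PA] M] MT AT, symmetric])
    also have "\<dots> + - (\<eta>\<^sup>2 \<cdot>\<^sub>m P) = F"
      unfolding F
    proof (rule minus_add_uminus_mat[symmetric])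
      show "(1\<^sub>m n - P * A) * M * M\<^sup>T * A\<^sup>T \<in> carrier_mat n m"
        by (rule mult_carrier_mat[OF mult_carrier_mat[OF mult_carrier_mat[OF minus_carrier_mat[OF PA] M] MT] AT])
    qed (use P in simp)
    finally show ?thesis .
  qed
  have det: "det G \<noteq> 0"
    unfolding GN
  proof (rule det_regularized_gram[OF N])
    fix v :: "real vec"
    assume "\<eta> = 0" and v: "v \<in> carrier_vec m" and 0: "N\<^sup>T *\<^sub>v v = 0\<^sub>v p"
    \<comment> \<open>Without regularization the rank bounds make A square and invertible.\<close>
    have "m \<le> r" using \<open>\<eta> = 0\<close> \<open>r < m \<Longrightarrow> \<eta> \<noteq> 0\<close> by (meson not_less)
    then have "k = m" using \<open>r \<le> k\<close> \<open>k \<le> n\<close> \<open>n \<le> m\<close> by simp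
    have "M\<^sup>T *\<^sub>v (A\<^sup>T *\<^sub>v v) = 0\<^sub>v p"
      using 0 A M v by (simp add: NT)
    then have "A\<^sup>T *\<^sub>v v = 0\<^sub>v n"
      using A v by (intro full_row_rank_transpose_inj[OF M rank_M]) auto
    then show "v = 0\<^sub>v m"
      using full_row_rank_transpose_inj[OF A _ v] rank_A \<open>k = m\<close> by simp
  qed
  have Gc: "G \<in> carrier_mat m m" using N by (auto simp: GN)
  note inv = mat_inv_of_det[OF Gc det, folded Gi_def]
  have f_BC: "f = (\<lambda>Z. (frobenius_norm (Z * B - C))\<^sup>2)"
    unfolding f B_def C_def N_def ..
  interpret matrix_regression n m "p + m" B C Gi
    by unfold_locales (use B C inv BB in auto)
  have f_err: "f = err" unfolding f_BC by (rule ext) (rule err_def[symmetric])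
  have Fc: "F \<in> carrier_mat n m" using B C by (auto simp: CB[symmetric])
  have K_eq: "K = F * Gi" by (simp add: K_def CB)
  \<comment> \<open>The normal equations give F K^T; the symmetry of Y Y^T turns it into K F^T = H.\<close>
  have eig: "K * B * (K * B)\<^sup>T = U * mat_diag n (\<lambda>i. lam (Suc i)) * U\<^sup>T"
  proof -
    have BT: "B\<^sup>T \<in> carrier_mat (p + m) m" and KT: "K\<^sup>T \<in> carrier_mat m n" using B K by simp_all
    have "K * B * (K * B)\<^sup>T = K * (B * B\<^sup>T) * K\<^sup>T"
      unfolding transpose_mult[OF K B] assoc_mult_mat[OF K B mult_carrier_mat[OF BT KT]]
        assoc_mult_mat[OF K mult_carrier_mat[OF B BT] KT] assoc_mult_mat[OF B BT KT] ..
    also have "\<dots> = F * K\<^sup>T" by (simp add: normal_equations CB)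
    finally have YY: "K * B * (K * B)\<^sup>T = F * K\<^sup>T" .
    have KB: "K * B \<in> carrier_mat n (p + m)" by (rule mult_carrier_mat[OF K B])
    have "K * B * (K * B)\<^sup>T = (K * B * (K * B)\<^sup>T)\<^sup>T"
      using transpose_mult[OF KB, of "(K * B)\<^sup>T" n] KB by simp
    also have "\<dots> = K * F\<^sup>T" unfolding YY transpose_mult[OF Fc KT] by simp
    also have "\<dots> = H" unfolding K_eq unfolding H Gi_def ..
    finally show ?thesis using H_decomp by (rule trans)
  qed
  have rn: "r \<le> n" using \<open>r \<le> k\<close> \<open>k \<le> n\<close> by simp
  have Zh: "Zhat = coord_proj U {..<r} * K"
  proof -
    have "coord_proj U {..<r} \<in> carrier_mat n n"
      by (rule orth_projD(1)[OF orth_proj_coord_proj[OF U]])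
    then show ?thesis
      unfolding Zhat first_cols_mult_transpose[OF U rn] K_eq Gi_def[symmetric]
      using Fc inv(1) by (rule assoc_mult_mat)
  qed
  have l: "lam (Suc i) \<le> lam (Suc j)" if "j < i" "i < n" for i j
    using lam_ordered[of "Suc j" "Suc i"] that by auto
  have rk: "r \<le> vec_space.rank n (C * B\<^sup>T)" using rank_F by (simp add: CB)
  note res = rank_constrained_minimizers[OF U eig l \<open>0 < r\<close> rn rk Zh]
  show ?thesis unfolding f_err using res \<open>0 < r\<close> by simp
qed

end
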